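(* Let $B^3 = \{x \in \mathbb{R}^3 : \|x\| \le 1\}$ be the solid unit ball, and let $SO_3$ be the group of rotations in $\mathbb{R}^3$, acting on $\mathbb{R}^3$. Then there exist subsets $\mathcal{B}_1, \mathcal{B}_2 \subseteq B^3$ that partition $B^3$ (that is, $\mathcal{B}_1 \cup \mathcal{B}_2 = B^3$ and $\mathcal{B}_1 \cap \mathcal{B}_2 = \emptyset$) such that $\mathcal{B}_1 \sim_{SO_3} B^3$ and $\mathcal{B}_2 \sim_{SO_3} B^3$.
   Context: Let a group $G$ act on a set $X$ and let $A, B \subseteq X$. $A$ and $B$ are $G$-equidecomposable, written $A \sim_G B$, if $A$ and $B$ can each be partitioned into the same finite number of respectively $G$-congruent pieces; that is, there are a positive integer $n$, sets $A_1,\dots,A_n$ and $B_1,\dots,B_n$ and elements $g_1,\dots,g_n \in G$ such that $A = \bigcup_{i=1}^n A_i$, $B = \bigcup_{i=1}^n B_i$, $A_i \cap A_j = \emptyset = B_i \cap B_j$ for all $i < j \le n$, and $g_i \cdot A_i = B_i$ for each $i \le n$. Here $G = SO_3$ and $X = \mathbb{R}^3$. The Axiom of Choice is assumed.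
   Formalization: The group SO_3 is replaced by the group generated by rotations about arbitrary axes, not only those through the origin (the orientation-preserving rigid motions); with linear SO_3 the claim is false, since every rotation fixes the origin, which would lie in both pieces. *)

theory Defs
  imports "HOL-Analysis.Analysis" "HOL-Algebra.Group_Action" "HOL-Algebra.Elementary_Groups"
begin

definition equidecomposable ::
  "('g, 'm) monoid_scheme \<Rightarrow> ('g \<Rightarrow> 'x \<Rightarrow> 'x) \<Rightarrow> 'x set \<Rightarrow> 'x set \<Rightarrow> bool"
  where
  "equidecomposable G \<phi> A B \<longleftrightarrow>
     (\<exists>(n::nat) (P :: nat \<Rightarrow> 'x set) (Q :: nat \<Rightarrow> 'x set) (g :: nat \<Rightarrow> 'g).
        n > 0 \<and>
        A = (\<Union>i\<in>{1..n}. P i) \<and> B = (\<Union>i\<in>{1..n}. Q i) \<and>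
        (\<forall>i\<in>{1..n}. \<forall>j\<in>{1..n}. i < j \<longrightarrow> P i \<inter> P j = {} \<and> Q i \<inter> Q j = {}) \<and>
        (\<forall>i\<in>{1..n}. g i \<in> carrier G \<and> \<phi> (g i) ` P i = Q i))"

text \<open>The rotation by the matrix \<open>R\<close> about the point \<open>c\<close>; its axis is the
  line through \<open>c\<close> in the direction of the axis of \<open>R\<close>.\<close>

definition rotation_about :: "real ^ 3 \<Rightarrow> real ^ 3 ^ 3 \<Rightarrow> real ^ 3 \<Rightarrow> real ^ 3"
  where "rotation_about c R x = c + R *v (x - c)"

text \<open>The ``group of rotations in \<open>\<real>\<^sup>3\<close>'' is the permutation group of \<open>\<real>\<^sup>3\<close> generated by
  the rotations about arbitrary axes, not only those through the origin. It is therefore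
  the group of orientation-preserving rigid motions, larger than the matrix group of
  orthogonal matrices of determinant 1. For the latter, acting linearly, no two disjoint
  sets can both be equidecomposable with the closed unit ball, because the origin is a
  common fixed point: see \<open>linear_rotations_not_paradoxical\<close> below.\<close>

definition rotation_group :: "(real ^ 3 \<Rightarrow> real ^ 3) monoid"
  where "rotation_group =
    subgroup_generated (BijGroup UNIV) {rotation_about c R | c R. rotation_matrix R}"

lemma rotation_about_Bij:
  assumes "rotation_matrix R"
  shows "rotation_about c R \<in> carrier (BijGroup UNIV)"
proof -
  have "orthogonal_matrix R"
    using assms by (simp add: rotation_matrix_def)
  then have R: "transpose R *v (R *v v) = v" "R *v (transpose R *v v) = v" for v
    by (simp_all only: orthogonal_matrix_def matrix_vector_mul_assoc matrix_vector_mul_lid)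
  have "bij (rotation_about c R)"
    by (rule o_bij[of "rotation_about c (transpose R)"])
      (simp_all add: fun_eq_iff rotation_about_def R del: transpose_matrix_vector)
  then show ?thesis
    by (simp add: BijGroup_def Bij_def)
qed

lemma rotation_group_action: "group_action rotation_group UNIV (\<lambda>f. f)"
proof -
  interpret group "BijGroup (UNIV :: (real ^ 3) set)"
    by (rule group_BijGroup)
  have "group_hom rotation_group (BijGroup UNIV) (\<lambda>f. f)"
  proof (intro group_hom.intro group_hom_axioms.intro)
    show "group rotation_group"
      unfolding rotation_group_def by (rule group_subgroup_generated)
    show "(\<lambda>f. f) \<in> hom rotation_group (BijGroup UNIV)"
      using carrier_subgroup_generated_subset
      unfolding rotation_group_def by (intro homI) (blast, simp)
  qed (rule group_BijGroup)
  then show ?thesis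
    by (simp add: group_action_def)
qed

lemma equidecomposable_fixed_point:
  assumes "equidecomposable G \<phi> A B" "p \<in> B"
    and "\<And>g. g \<in> carrier G \<Longrightarrow> inj (\<phi> g) \<and> \<phi> g p = p"
  shows "p \<in> A"
proof -
  from assms(1) obtain n :: nat and P Q g where
    A: "A = (\<Union>i\<in>{1..n}. P i)" and B: "B = (\<Union>i\<in>{1..n}. Q i)"
    and g: "\<forall>i\<in>{1..n}. g i \<in> carrier G \<and> \<phi> (g i) ` P i = Q i"
    unfolding equidecomposable_def by (elim exE conjE) (rule that)
  from \<open>p \<in> B\<close> obtain i where i: "i \<in> {1..n}" "p \<in> Q i"
    unfolding B by (rule UN_E)
  have gi: "g i \<in> carrier G" "\<phi> (g i) ` P i = Q i"
    using bspec[OF g i(1)] by blast+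
  obtain x where x: "p = \<phi> (g i) x" "x \<in> P i"
    using i(2) unfolding gi(2)[symmetric] by (rule imageE)
  have inj: "inj (\<phi> (g i))" and fix_p: "\<phi> (g i) p = p"
    using assms(3)[OF gi(1)] by blast+
  have "\<phi> (g i) x = \<phi> (g i) p"
    using x(1)[symmetric] fix_p[symmetric] by (rule trans)
  with inj have "x = p"
    by (rule injD)
  then have "p \<in> P i"
    using x(2) by (rule subst)
  with i(1) show ?thesis
    unfolding A by (rule UN_I)
qed

lemma linear_rotations_not_paradoxical:
  fixes A B :: "(real ^ 3) set" and G :: "(real ^ 3 ^ 3, 'm) monoid_scheme"
  assumes "carrier G = Collect rotation_matrix"
    and "equidecomposable G (*v) A (cball 0 1)" "equidecomposable G (*v) B (cball 0 1)"
  shows "A \<inter> B \<noteq> {}"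
proof -
  have inj: "inj ((*v) R)" if "rotation_matrix R" for R :: "real ^ 3 ^ 3"
  proof (rule inj_on_inverseI)
    show "transpose R *v (R *v v) = v" for v
      using that by (simp only: rotation_matrix_def orthogonal_matrix_def
          matrix_vector_mul_assoc matrix_vector_mul_lid)
  qed
  have fix0: "inj ((*v) R) \<and> R *v 0 = 0" if "R \<in> carrier G" for R
    using that inj assms(1) by (simp only: mem_Collect_eq matrix_vector_mult_0_right)
  have "0 \<in> A" "0 \<in> B"
    using equidecomposable_fixed_point[OF assms(2) _ fix0]
      equidecomposable_fixed_point[OF assms(3) _ fix0]
    by (simp_all only: centre_in_cball zero_le_one)
  then show ?thesis
    by blast
qed

end

theory Submission
  imports Defs
begin

text \<open>The rotations by \<open>arccos (3/5)\<close> about the \<open>x\<close>- and \<open>z\<close>-axes generate a free group of rational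
  matrices. The axis of a nontrivial element is a rational line through the origin, so the group
  acts freely on the points \<open>X\<close> of the ball that lie on no rational line, and sorting these points
  by the first letter of a word yields two piecewise congruent embeddings of \<open>X\<close> into \<open>X\<close> with
  disjoint images. Rotations through 60 degrees move the rational lines into \<open>X\<close>: about the
  \<open>z\<close>-axis for points off that axis, about the \<open>x\<close>-axis for the other points except the origin, and
  about an axis missing the origin for the origin. Hence finitely many disjoint copies of \<open>X\<close> absorb
  the ball, the ball embeds twice disjointly into itself, and the Banach-Schroeder-Bernstein
  argument turns embeddings into equidecompositions.\<close>

section \<open>Piecewise congruent embeddings\<close>

context group_action
begin

lemma one_closed: "\<one> \<in> carrier G"
  using group_hom.axioms(1)[OF group_hom] by (intro monoid.one_closed group.is_monoid)

lemma mult_closed: "g \<in> carrier G \<Longrightarrow> h \<in> carrier G \<Longrightarrow> g \<otimes> h \<in> carrier G"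
  using group_hom.axioms(1)[OF group_hom] by (intro monoid.m_closed group.is_monoid)

text \<open>The pieces stay implicit: a finite set of group elements realizing \<open>f\<close>
  pointwise survives composition, inversion and gluing without any bookkeeping of
  partitions.\<close>

definition embedding :: "'c set \<Rightarrow> 'c set \<Rightarrow> ('c \<Rightarrow> 'c) \<Rightarrow> bool"
  where "embedding A B f \<longleftrightarrow> inj_on f A \<and> f ` A \<subseteq> B \<and>
    (\<exists>F. finite F \<and> F \<subseteq> carrier G \<and> (\<forall>x\<in>A. \<exists>g\<in>F. f x = \<phi> g x))"

lemma embeddingI:
  assumes "inj_on f A" "f ` A \<subseteq> B" "finite F" "F \<subseteq> carrier G"
    "\<And>x. x \<in> A \<Longrightarrow> \<exists>g\<in>F. f x = \<phi> g x"
  shows "embedding A B f"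
  using assms unfolding embedding_def by blast

lemma embeddingE:
  assumes "embedding A B f"
  obtains F where "inj_on f A" "f ` A \<subseteq> B" "finite F" "F \<subseteq> carrier G"
    "\<forall>x\<in>A. \<exists>g\<in>F. f x = \<phi> g x"
  using assms unfolding embedding_def by blast

lemma embedding_action:
  assumes "g \<in> carrier G" "A \<subseteq> E" "\<phi> g ` A \<subseteq> B"
  shows "embedding A B (\<phi> g)"
proof (rule embeddingI[where F = "{g}"])
  show "inj_on (\<phi> g) A"
    using inj_prop[OF assms(1)] assms(2) by (rule inj_on_subset)
qed (use assms in auto)

lemma embedding_id:
  assumes "A \<subseteq> B" "A \<subseteq> E"
  shows "embedding A B (\<lambda>x. x)"
proof (rule embeddingI[where F = "{\<one>}"])
  show "\<exists>g\<in>{\<one>}. x = \<phi> g x" if "x \<in> A" for x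
    using that assms(2) by (auto simp flip: id_eq_one)
  show "{\<one>} \<subseteq> carrier G"
    using one_closed by simp
qed (use assms in auto)

lemma embedding_subset:
  assumes "embedding A B f" "A' \<subseteq> A"
  shows "embedding A' B f"
  using assms unfolding embedding_def by (meson image_mono inj_on_subset order_trans subsetD)

lemma embedding_comp:
  assumes "embedding A B f" "embedding B C h" "A \<subseteq> E"
  shows "embedding A C (h \<circ> f)"
proof -
  obtain F where F: "inj_on f A" "f ` A \<subseteq> B" "finite F" "F \<subseteq> carrier G"
    "\<forall>x\<in>A. \<exists>g\<in>F. f x = \<phi> g x"
    using assms(1) by (rule embeddingE)
  obtain H where H: "inj_on h B" "h ` B \<subseteq> C" "finite H" "H \<subseteq> carrier G"
    "\<forall>x\<in>B. \<exists>g\<in>H. h x = \<phi> g x"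
    using assms(2) by (rule embeddingE)
  show ?thesis
  proof (rule embeddingI[where F = "(\<lambda>(k, g). k \<otimes> g) ` (H \<times> F)"])
    show "inj_on (h \<circ> f) A"
      using F(1,2) H(1) by (meson comp_inj_on inj_on_subset)
    show "(h \<circ> f) ` A \<subseteq> C"
      using F(2) H(2) by auto
    show "\<exists>g\<in>(\<lambda>(k, g). k \<otimes> g) ` (H \<times> F). (h \<circ> f) x = \<phi> g x" if x: "x \<in> A" for x
    proof -
      obtain g where g: "g \<in> F" "f x = \<phi> g x"
        using F(5) x by blast
      moreover obtain k where k: "k \<in> H" "h (f x) = \<phi> k (f x)"
        using H(5) F(2) x by blast
      ultimately have "(h \<circ> f) x = \<phi> (k \<otimes> g) x"
        using composition_rule[of x k g] x subsetD[OF assms(3)] subsetD[OF F(4)] subsetD[OF H(4)] by auto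
      then show ?thesis
        using g k by force
    qed
    show "(\<lambda>(k, g). k \<otimes> g) ` (H \<times> F) \<subseteq> carrier G"
      using mult_closed subsetD[OF F(4)] subsetD[OF H(4)] by auto
  qed (use F(3) H(3) in auto)
qed

lemma embedding_inv_into:
  assumes "embedding A B f" "A \<subseteq> E"
  shows "embedding (f ` A) A (inv_into A f)"
proof -
  obtain F where F: "inj_on f A" "f ` A \<subseteq> B" "finite F" "F \<subseteq> carrier G"
    "\<forall>x\<in>A. \<exists>g\<in>F. f x = \<phi> g x"
    using assms(1) by (rule embeddingE)
  show ?thesis
  proof (rule embeddingI[where F = "m_inv G ` F"])
    show "\<exists>g\<in>m_inv G ` F. inv_into A f y = \<phi> g y" if y: "y \<in> f ` A" for y
    proof -
      obtain x where x: "x \<in> A" "y = f x"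
        using y by blast
      moreover obtain g where g: "g \<in> F" "f x = \<phi> g x"
        using F(5) x(1) by blast
      ultimately have "\<phi> (inv g) y = inv_into A f y"
        using orbit_sym_aux[of g x y] inv_into_f_f[OF F(1) x(1)]
          subsetD[OF F(4)] subsetD[OF assms(2)] by auto
      then show ?thesis
        using g(1) by force
    qed
    show "m_inv G ` F \<subseteq> carrier G"
      using F(4) group.inv_closed[OF group_hom.axioms(1)[OF group_hom]] by blast
  qed (use F in \<open>auto intro: inj_on_inv_into\<close>)
qed

text \<open>On the overlap \<open>f\<close> takes precedence, so only the values of \<open>h\<close>
  on \<open>B - A\<close> have to avoid the image of \<open>f\<close>, and \<open>A\<close> and
  \<open>B\<close> may overlap.\<close>

lemma embedding_If:
  assumes f: "embedding A C f" and h: "embedding B C h"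
    and disj: "f ` A \<inter> h ` (B - A) = {}"
  shows "embedding (A \<union> B) C (\<lambda>x. if x \<in> A then f x else h x)"
proof -
  obtain F where F: "inj_on f A" "f ` A \<subseteq> C" "finite F" "F \<subseteq> carrier G"
    "\<forall>x\<in>A. \<exists>g\<in>F. f x = \<phi> g x"
    using f by (rule embeddingE)
  obtain H where H: "inj_on h B" "h ` B \<subseteq> C" "finite H" "H \<subseteq> carrier G"
    "\<forall>x\<in>B. \<exists>g\<in>H. h x = \<phi> g x"
    using h by (rule embeddingE)
  show ?thesis
  proof (rule embeddingI[where F = "F \<union> H"])
    show "inj_on (\<lambda>x. if x \<in> A then f x else h x) (A \<union> B)"
    proof -
      have "inj_on (\<lambda>x. if x \<in> A then f x else h x) A" "inj_on (\<lambda>x. if x \<in> A then f x else h x) (B - A)"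
        using F(1) inj_on_subset[OF H(1), of "B - A"] by (auto simp: inj_on_def)
      moreover have "(\<lambda>x. if x \<in> A then f x else h x) ` A = f ` A"
        "(\<lambda>x. if x \<in> A then f x else h x) ` (B - A) = h ` (B - A)"
        by (auto intro!: image_cong)
      ultimately have "inj_on (\<lambda>x. if x \<in> A then f x else h x) (A \<union> (B - A))"
        using disj unfolding inj_on_Un by auto
      then show ?thesis
        by simp
    qed
  qed (use F H in auto)
qed

lemma equidecomposable_if_embedding:
  assumes f: "embedding A B f" and onto: "f ` A = B"
  shows "equidecomposable G \<phi> A B"
proof -
  obtain F where F: "inj_on f A" "f ` A \<subseteq> B" "finite F" "F \<subseteq> carrier G"
    "\<forall>x\<in>A. \<exists>g\<in>F. f x = \<phi> g x"
    using f by (rule embeddingE)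
  define n where "n = card (insert \<one> F)"
  obtain g where g: "bij_betw g {1..n} (insert \<one> F)"
    using ex_bij_betw_nat_finite_1[of "insert \<one> F"] F(3) unfolding n_def by auto
  have "n > 0"
    using F(3) by (simp add: n_def card_gt_0_iff)
  have gG: "g i \<in> carrier G" if "i \<in> {1..n}" for i
    using bij_betwE[OF g, rule_format, OF that] subsetD[OF F(4)] one_closed by auto
  \<comment> \<open>Each point goes to the least index whose group element realizes \<open>f\<close>
    there; this makes the pieces disjoint, and injectivity of \<open>f\<close> keeps their images
    disjoint.\<close>
  define P where "P i = {x \<in> A. f x = \<phi> (g i) x \<and> (\<forall>j\<in>{1..<i}. f x \<noteq> \<phi> (g j) x)}" for i
  have cover: "\<exists>i\<in>{1..n}. x \<in> P i" if x: "x \<in> A" for x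
  proof -
    obtain k where "k \<in> F" "f x = \<phi> k x"
      using F(5) x by blast
    then have ex: "\<exists>i. i \<in> {1..n} \<and> f x = \<phi> (g i) x"
      using g unfolding bij_betw_def by (metis imageE insertCI)
    define i where "i = (LEAST i. i \<in> {1..n} \<and> f x = \<phi> (g i) x)"
    have i: "i \<in> {1..n}" "f x = \<phi> (g i) x"
      using LeastI_ex[OF ex] unfolding i_def by auto
    moreover have "f x \<noteq> \<phi> (g j) x" if "j \<in> {1..<i}" for j
      using not_less_Least[of j "\<lambda>i. i \<in> {1..n} \<and> f x = \<phi> (g i) x"] that i(1)
      unfolding i_def[symmetric] by auto
    ultimately show ?thesis
      using x unfolding P_def by blast
  qed
  have A: "A = (\<Union>i\<in>{1..n}. P i)"
    using cover by (auto simp: P_def)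
  have disj: "P i \<inter> P j = {}" if "i \<in> {1..n}" "i < j" for i j
    using that by (auto simp: P_def)
  have image: "\<phi> (g i) ` P i = f ` P i" for i
    by (rule image_cong) (auto simp: P_def)
  have "f ` P i \<inter> f ` P j = {}" if "i \<in> {1..n}" "i < j" for i j
    using inj_on_image_Int[OF F(1), of "P i" "P j"] disj[OF that] by (auto simp: P_def)
  moreover have "B = (\<Union>i\<in>{1..n}. f ` P i)"
    using onto A by blast
  ultimately show ?thesis
    unfolding equidecomposable_def using \<open>n > 0\<close> A disj image gG
    by (intro exI[of _ n] exI[of _ P] exI[of _ "\<lambda>i. f ` P i"] exI[of _ g]) auto
qed

text \<open>\<open>f\<close> and \<open>h\<close> provide two disjoint copies of \<open>X\<close>
  inside \<open>X\<close>; one receives \<open>A\<close>, the other \<open>B\<close>. Repetition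
  lets \<open>X\<close> absorb any finite union of sets embedding into it.\<close>

lemma embedding_Un:
  assumes f: "embedding X X f" and h: "embedding X X h" and disj: "f ` X \<inter> h ` X = {}"
    and u: "embedding A X u" and v: "embedding B X v" and E: "A \<subseteq> E" "B \<subseteq> E"
  shows "\<exists>k. embedding (A \<union> B) X k"
proof -
  have "embedding (A \<union> B) X (\<lambda>x. if x \<in> A then (f \<circ> u) x else (h \<circ> v) x)"
    (is "embedding _ _ ?k")
  proof (rule embedding_If)
    show "embedding A X (f \<circ> u)"
      using u f E(1) by (rule embedding_comp)
    show "embedding B X (h \<circ> v)"
      using v h E(2) by (rule embedding_comp)
    show "(f \<circ> u) ` A \<inter> (h \<circ> v) ` (B - A) = {}"
    proof -
      have "(f \<circ> u) ` A \<subseteq> f ` X" "(h \<circ> v) ` (B - A) \<subseteq> h ` X"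
        using u v unfolding embedding_def by auto
      then show ?thesis
        using disj by blast
    qed
  qed
  then show ?thesis
    by (rule exI[of _ ?k])
qed

text \<open>Intended for the sets of points whose words begin with a letter (\<open>P\<close>) and
  with its inverse (\<open>Q\<close>): points of \<open>Q\<close> stay, all others are moved into
  \<open>P\<close>, and disjointness of the two gives injectivity.\<close>

lemma embedding_pieces:
  assumes g: "g \<in> carrier G" and X: "X \<subseteq> E" and PQ: "P \<inter> Q = {}" "Q \<subseteq> X"
    and image: "\<And>x. x \<in> X \<Longrightarrow> x \<notin> Q \<Longrightarrow> \<phi> g x \<in> P"
  shows "embedding X (P \<union> Q) (\<lambda>x. if x \<in> Q then x else \<phi> g x)"
proof -
  have "embedding (Q \<union> (X - Q)) (P \<union> Q) (\<lambda>x. if x \<in> Q then x else \<phi> g x)"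
  proof (rule embedding_If)
    show "embedding Q (P \<union> Q) (\<lambda>x. x)"
      using PQ X by (intro embedding_id) auto
    show "embedding (X - Q) (P \<union> Q) (\<phi> g)"
      using X image by (intro embedding_action g) auto
  qed (use PQ image in auto)
  then show ?thesis
    using PQ(2) by (simp add: Un_absorb1)
qed

lemma equidecomposable_Schroeder_Bernstein:
  assumes f: "embedding A B f" and h: "embedding B A h" and E: "A \<subseteq> E" "B \<subseteq> E"
  shows "equidecomposable G \<phi> A B"
proof -
  define C where "C = lfp (\<lambda>C. A - h ` (B - f ` C))"
  have "mono (\<lambda>C. A - h ` (B - f ` C))"
    by (rule monoI) blast
  then have C: "C = A - h ` (B - f ` C)"
    unfolding C_def by (rule lfp_unfold)
  have fA: "f ` A \<subseteq> B" and hB: "h ` B \<subseteq> A" "inj_on h B"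
    using f h by (auto simp: embedding_def)
  have CA: "C \<subseteq> A" and AC: "A - C = h ` (B - f ` C)"
    using C hB(1) by blast+
  let ?k = "inv_into (B - f ` C) h"
  have k: "embedding (A - C) (B - f ` C) ?k"
    unfolding AC
    by (rule embedding_inv_into[of _ A]) (use embedding_subset[OF h] E in auto)
  have kim: "?k ` (A - C) = B - f ` C"
    unfolding AC using hB(2) by (intro inv_into_image_cancel) (auto intro: inj_on_subset)
  let ?u = "\<lambda>x. if x \<in> C then f x else ?k x"
  have "embedding (C \<union> (A - C)) B ?u"
  proof (rule embedding_If)
    show "embedding C B f"
      using f CA by (rule embedding_subset)
    show "embedding (A - C) B ?k"
      using k unfolding embedding_def by blast
    show "f ` C \<inter> ?k ` (A - C - C) = {}"
      using kim by blast
  qed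
  then have "embedding A B ?u"
    using CA by (simp add: Un_absorb1)
  moreover have "?u ` A = f ` C \<union> ?k ` (A - C)"
    using CA by (auto simp: image_iff)
  then have "?u ` A = B"
    unfolding kim using image_mono[OF CA, of f] fA by (simp add: Un_absorb1)
  ultimately show ?thesis
    by (rule equidecomposable_if_embedding)
qed

end

section \<open>Free actions of the free group of rank two\<close>

text \<open>In a letter the first component selects one of the two generators and the second the
  sign of its exponent.\<close>

definition inverse_letter :: "bool \<times> bool \<Rightarrow> bool \<times> bool"
  where "inverse_letter s = (fst s, \<not> snd s)"

abbreviation reduced :: "(bool \<times> bool) list \<Rightarrow> bool"
  where "reduced \<equiv> successively (\<lambda>s t. t \<noteq> inverse_letter s)"

abbreviation inverse_word :: "(bool \<times> bool) list \<Rightarrow> (bool \<times> bool) list"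
  where "inverse_word w \<equiv> rev (map inverse_letter w)"

lemma inverse_letter_inverse [simp]: "inverse_letter (inverse_letter s) = s"
  by (simp add: inverse_letter_def)

lemma inverse_letter_neq [simp]: "inverse_letter s \<noteq> s" "s \<noteq> inverse_letter s"
  by (auto simp: inverse_letter_def prod_eq_iff)

lemma reduced_inverse_word: "reduced (inverse_word w) \<longleftrightarrow> reduced w"
proof -
  have *: "(inverse_letter s \<noteq> inverse_letter (inverse_letter t)) = (t \<noteq> inverse_letter s)" for s t
    by auto
  show ?thesis
    by (simp only: successively_rev successively_map *)
qed

lemma foldr_inverse_word:
  assumes "\<And>s x. R (inverse_letter s) (R s x) = x"
  shows "foldr R (inverse_word w) (foldr R w x) = x"
  by (induction w) (simp_all add: assms)

text \<open>A letter put in front of a reduced word either cancels its head, leaving the reduced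
  tail, or gives a reduced word again.\<close>

lemma ex_reduced_foldr:
  assumes "\<And>s x. R (inverse_letter s) (R s x) = x"
  shows "\<exists>w'. reduced w' \<and> foldr R w' x = foldr R w x"
proof (induction w)
  case (Cons s w)
  then obtain w' where w': "reduced w'" "foldr R w' x = foldr R w x"
    by blast
  show ?case
  proof (cases "w' \<noteq> [] \<and> hd w' = inverse_letter s")
    case True
    then obtain v where v: "w' = inverse_letter s # v"
      by (cases w') auto
    then have "foldr R v x = R s (foldr R w' x)"
      using assms[of "inverse_letter s"] by simp
    moreover have "reduced v"
      using w'(1) v by (auto simp: successively_Cons)
    ultimately show ?thesis
      using w'(2) by (intro exI[of _ v]) simp
  next
    case False
    then show ?thesis
      using w' by (intro exI[of _ "s # w'"]) (auto simp: successively_Cons)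
  qed
qed (auto intro: exI[of _ "[]"])

text \<open>After choosing a base point in every orbit, each point is reached from it by a reduced
  word, and freeness makes the first letter unique. A word not beginning with the inverse of
  \<open>s\<close> stays reduced when \<open>s\<close> is put in front. Base points themselves have
  the empty word and lie in no piece.\<close>

lemma free_action_pieces:
  fixes R :: "bool \<times> bool \<Rightarrow> 'x \<Rightarrow> 'x"
  assumes inv: "\<And>s x. R (inverse_letter s) (R s x) = x"
    and closed: "\<And>s x. x \<in> X \<Longrightarrow> R s x \<in> X"
    and free: "\<And>w x. x \<in> X \<Longrightarrow> reduced w \<Longrightarrow> w \<noteq> [] \<Longrightarrow> foldr R w x \<noteq> x"
  obtains P where "\<And>s. P s \<subseteq> X" "\<And>s t. s \<noteq> t \<Longrightarrow> P s \<inter> P t = {}"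
    "\<And>s x. x \<in> X \<Longrightarrow> x \<notin> P (inverse_letter s) \<Longrightarrow> R s x \<in> P s"
proof
  define orb where "orb x = range (\<lambda>w. foldr R w x)" for x
  \<comment> \<open>The choice depends on the set \<open>orb x\<close> alone, so all points of an
    orbit share one base point.\<close>
  define m where "m x = (SOME y. y \<in> orb x)" for x
  have closed': "foldr R w x \<in> X" if "x \<in> X" for w x
    using that by (induction w) (auto intro: closed)
  have orb_R: "orb (R s x) = orb x" for s x
  proof -
    have "orb (R s x) \<subseteq> orb x" for s x
    proof -
      have "foldr R w (R s x) = foldr R (w @ [s]) x" for w
        by simp
      then show ?thesis
        unfolding orb_def by (metis image_subsetI rangeI)
    qed
    from this[of s x] this[of "inverse_letter s" "R s x"] show ?thesis
      by (auto simp: inv)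
  qed
  have m_orb: "m x \<in> orb x" for x
    unfolding m_def by (rule someI[of _ x]) (auto simp: orb_def intro: range_eqI[of _ _ "[]"])
  have m_R: "m (R s x) = m x" for s x
    by (simp add: m_def orb_R)
  define P where "P s = {x \<in> X. \<exists>w. reduced (s # w) \<and> foldr R (s # w) (m x) = x}" for s
  have word: "\<exists>w. reduced w \<and> foldr R w (m x) = x" for x
  proof -
    obtain w where "m x = foldr R w x"
      using m_orb[of x] by (auto simp: orb_def)
    then have "foldr R (inverse_word w) (m x) = x"
      using foldr_inverse_word[of R, OF inv] by simp
    then show ?thesis
      using ex_reduced_foldr[of R, OF inv] by metis
  qed
  show "P s \<subseteq> X" for s
    by (auto simp: P_def)
  show "P s \<inter> P t = {}" if "s \<noteq> t" for s t
  proof (rule ccontr)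
    assume "P s \<inter> P t \<noteq> {}"
    then obtain x v w where x: "x \<in> X" and v: "reduced (s # v)" "foldr R (s # v) (m x) = x"
      and w: "reduced (t # w)" "foldr R (t # w) (m x) = x"
      by (auto simp: P_def)
    have "reduced (inverse_word (s # v))"
      using v(1) by (simp only: reduced_inverse_word)
    \<comment> \<open>The letters at the junction are \<open>inverse_letter s\<close> and
      \<open>t\<close>, which do not cancel because \<open>s\<close> and \<open>t\<close> differ;
      the resulting nonempty reduced word fixes \<open>m x\<close>.\<close>
    then have "reduced (inverse_word (s # v) @ (t # w))"
      using w(1) that by (auto simp: successively_append_iff)
    moreover have "foldr R (inverse_word (s # v) @ (t # w)) (m x) = m x"
      using foldr_inverse_word[of R, OF inv, of "s # v" "m x"] v(2) w(2)
      by (simp only: foldr_append comp_apply)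
    moreover have "m x \<in> X"
      using m_orb[of x] closed'[OF x] by (auto simp: orb_def)
    ultimately show False
      using free by blast
  qed
  show "R s x \<in> P s" if x: "x \<in> X" "x \<notin> P (inverse_letter s)" for s x
  proof -
    obtain w where w: "reduced w" "foldr R w (m x) = x"
      using word by blast
    have "w = [] \<or> hd w \<noteq> inverse_letter s"
      using x w by (cases w) (auto simp: P_def)
    then have "reduced (s # w)"
      using w(1) by (auto simp: successively_Cons)
    then show ?thesis
      using w(2) closed[OF x(1), of s] by (auto simp: P_def m_R)
  qed
qed

section \<open>A free group of rational rotations\<close>

definition rotz :: "real \<Rightarrow> real \<Rightarrow> real ^ 3 ^ 3"
  where "rotz c s = vector [vector [c, - s, 0], vector [s, c, 0], vector [0, 0, 1]]"

definition rotx :: "real \<Rightarrow> real \<Rightarrow> real ^ 3 ^ 3"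
  where "rotx c s = vector [vector [1, 0, 0], vector [0, c, - s], vector [0, s, c]]"

lemma rotz_mult [simp]:
  "(rotz c s *v x) $ 1 = c * x $ 1 - s * x $ 2"
  "(rotz c s *v x) $ 2 = s * x $ 1 + c * x $ 2"
  "(rotz c s *v x) $ 3 = x $ 3"
  by (simp_all add: rotz_def matrix_vector_mult_def sum_3)

lemma rotx_mult [simp]:
  "(rotx c s *v x) $ 1 = x $ 1"
  "(rotx c s *v x) $ 2 = c * x $ 2 - s * x $ 3"
  "(rotx c s *v x) $ 3 = s * x $ 2 + c * x $ 3"
  by (simp_all add: rotx_def matrix_vector_mult_def sum_3)

lemma transpose_rot:
  "transpose (rotz c s) = rotz c (- s)" "transpose (rotx c s) = rotx c (- s)"
  by (simp_all add: rotz_def rotx_def transpose_def vec_eq_iff forall_3)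

lemma rotation_matrix_rot:
  assumes "c\<^sup>2 + s\<^sup>2 = 1"
  shows "rotation_matrix (rotz c s)" "rotation_matrix (rotx c s)"
proof -
  have "c * c + s * s = 1" "s * s + c * c = 1"
    using assms by (simp_all add: power2_eq_square)
  then show "rotation_matrix (rotz c s)" "rotation_matrix (rotx c s)"
    unfolding rotation_matrix_def orthogonal_matrix_def transpose_rot
    by (simp_all add: rotz_def rotx_def matrix_matrix_mult_def mat_def
        vec_eq_iff forall_3 sum_3 det_3 mult.commute[of s c])
qed

text \<open>The triple 3, 4, 5 makes the entries rational with denominator 5, so that
  \<open>5 *\<^sub>R gen s\<close> is integral and can be studied modulo 5.\<close>

definition gen :: "bool \<times> bool \<Rightarrow> real ^ 3 ^ 3"
  where "gen s = (if fst s then rotx else rotz) (3/5) (if snd s then 4/5 else - 4/5)"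

definition word_matrix :: "(bool \<times> bool) list \<Rightarrow> real ^ 3 ^ 3"
  where "word_matrix w = foldr (\<lambda>s M. gen s ** M) w (mat 1)"

lemma word_matrix_simps [simp]:
  "word_matrix [] = mat 1" "word_matrix (s # w) = gen s ** word_matrix w"
  by (simp_all add: word_matrix_def)

lemma word_matrix_append: "word_matrix (v @ w) = word_matrix v ** word_matrix w"
  by (induction v) (simp_all add: matrix_mul_assoc)

lemma foldr_gen: "foldr (\<lambda>s. (*v) (gen s)) w x = word_matrix w *v x"
proof (induction w)
  case (Cons s w)
  then show ?case
    by (simp only: foldr.simps comp_apply word_matrix_simps matrix_vector_mul_assoc)
qed simp

lemma rotation_matrix_gen: "rotation_matrix (gen s)"
  by (auto simp: gen_def intro!: rotation_matrix_rot simp: power2_eq_square)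

lemma transpose_gen: "transpose (gen s) = gen (inverse_letter s)"
  by (auto simp: gen_def inverse_letter_def transpose_rot)

lemma orthogonal_word_matrix: "orthogonal_matrix (word_matrix w)"
  by (induction w) (use rotation_matrix_gen in
    \<open>auto simp: rotation_matrix_def intro: orthogonal_matrix_mul orthogonal_matrix_id\<close>)

lemma gen_inverse_letter: "gen (inverse_letter s) ** gen s = mat 1"
  using rotation_matrix_gen[of s] transpose_gen[of s]
  by (simp add: rotation_matrix_def orthogonal_matrix_def)

lemma gen_mult_inverse_letter: "gen (inverse_letter s) *v (gen s *v x) = x"
  by (simp only: matrix_vector_mul_assoc gen_inverse_letter matrix_vector_mul_lid)

lemma Rats_matrix_mult:
  assumes "\<And>i j. A $ i $ j \<in> \<rat>" "\<And>i j. B $ i $ j \<in> \<rat>"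
  shows "(A ** B) $ i $ j \<in> (\<rat> :: real set)"
  unfolding matrix_matrix_mult_def using assms by (auto intro!: Rats_sum)

lemma Rats_gen: "gen s $ i $ j \<in> \<rat>"
  using exhaust_3[of i] exhaust_3[of j] by (auto simp: gen_def rotx_def rotz_def)

lemma Rats_word_matrix: "word_matrix w $ i $ j \<in> \<rat>"
  by (induction w arbitrary: i j) (auto simp: mat_def intro!: Rats_matrix_mult Rats_gen)

section \<open>Action of reduced words modulo 5\<close>

definition dir :: "bool \<times> bool \<Rightarrow> real ^ 3"
  where "dir s = (let k = if snd s then 4 else - 4 in
    if fst s then vector [0, 3, k] else vector [3, k, 0])"

text \<open>Modulo 5, the integer matrix \<open>5 *\<^sub>R gen s\<close> has rank one and image spanned by \<open>dir s\<close>,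
  and its kernel contains \<open>dir t\<close> only for \<open>t = inverse_letter s\<close>.\<close>

lemma gen_dir:
  assumes "t \<noteq> inverse_letter s"
  obtains d :: int and y where "\<not> 5 dvd d" "\<And>i. y $ i \<in> \<int>"
    "5 *\<^sub>R (gen s *v dir t) = of_int d *\<^sub>R dir s + 5 *\<^sub>R y"
proof -
  define k :: "bool \<times> bool \<Rightarrow> int" where "k u = (if snd u then 4 else - 4)" for u
  have k: "k u * k u = 16" "\<not> 5 dvd k u" for u
    by (auto simp: k_def)
  have k': "of_int (k u) * of_int (k u) = (16 :: real)" for u
    using k(1)[of u] by (metis of_int_mult of_int_numeral)
  have gen: "gen u = (if fst u then rotx else rotz) (3/5) (of_int (k u) / 5)" for u
    by (simp add: gen_def k_def)
  have dir: "dir u = (if fst u then vector [0, 3, of_int (k u)] else vector [3, of_int (k u), 0])" for u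
    by (simp add: dir_def k_def)
  \<comment> \<open>Equal axes force \<open>t = s\<close>, where \<open>dir s\<close> is an
    eigenvector modulo 5 with eigenvalue 6; otherwise the factor is read off the product. The vector
    \<open>y\<close> collects the multiples of 5, using 9 + 16 = 25.\<close>
  define d where "d = (if fst s = fst t then 6 else if fst s then k t else - k s)"
  define y :: "real ^ 3" where "y = (if fst s then if fst t then vector [0, -5, 0] else vector [3, 0, 0]
    else if fst t then vector [0, 5, of_int (k t)] else vector [-5, 0, 0])"
  show ?thesis
  proof
    show "\<not> 5 dvd d"
      using k(2) by (auto simp: d_def)
    show "y $ i \<in> \<int>" for i
      using exhaust_3[of i] by (auto simp: y_def)
    have "t = s" if "fst s = fst t"
      using that assms by (auto simp: inverse_letter_def prod_eq_iff)
    then show "5 *\<^sub>R (gen s *v dir t) = of_int d *\<^sub>R dir s + 5 *\<^sub>R y"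
      by (auto simp: vec_eq_iff forall_3 gen dir d_def y_def k' field_simps)
  qed
qed

text \<open>The leftmost letter acts last, so its direction survives modulo 5; each letter
  contributes a factor prime to 5, and so does their product since 5 is prime.\<close>

lemma word_matrix_dir:
  assumes "reduced (w @ [t])"
  shows "\<exists>(c :: int) y. \<not> 5 dvd c \<and> (\<forall>i. y $ i \<in> \<int>) \<and>
    5 ^ length w *\<^sub>R (word_matrix w *v dir t) = of_int c *\<^sub>R dir (hd (w @ [t])) + 5 *\<^sub>R y"
  using assms
proof (induction w)
  case Nil
  show ?case
    by (intro exI[of _ 1] exI[of _ 0]) simp
next
  case (Cons s w)
  define r where "r = hd (w @ [t])"
  have "reduced (w @ [t])" and r: "r \<noteq> inverse_letter s"
    using Cons.prems by (auto simp: successively_Cons r_def)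
  then obtain c :: int and y where c: "\<not> 5 dvd c" "\<forall>i. y $ i \<in> \<int>"
    "5 ^ length w *\<^sub>R (word_matrix w *v dir t) = of_int c *\<^sub>R dir r + 5 *\<^sub>R y"
    using Cons.IH unfolding r_def by blast
  obtain d :: int and z where d: "\<not> 5 dvd d" "\<And>i. z $ i \<in> \<int>"
    "5 *\<^sub>R (gen s *v dir r) = of_int d *\<^sub>R dir s + 5 *\<^sub>R z"
    using gen_dir[OF r] by blast
  have "5 ^ length (s # w) *\<^sub>R (word_matrix (s # w) *v dir t)
      = 5 *\<^sub>R (gen s *v (5 ^ length w *\<^sub>R (word_matrix w *v dir t)))"
    by (simp add: matrix_vector_mul_assoc matrix_vector_mult_scaleR)
  also have "\<dots> = of_int c *\<^sub>R (5 *\<^sub>R (gen s *v dir r)) + 5 *\<^sub>R (5 *\<^sub>R (gen s *v y))"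
    by (simp add: c(3) matrix_vector_right_distrib matrix_vector_mult_scaleR algebra_simps)
  also have "\<dots> = of_int (c * d) *\<^sub>R dir s + 5 *\<^sub>R (of_int c *\<^sub>R z + 5 *\<^sub>R (gen s *v y))"
    by (simp add: d(3) algebra_simps)
  finally have "5 ^ length (s # w) *\<^sub>R (word_matrix (s # w) *v dir t)
      = of_int (c * d) *\<^sub>R dir (hd ((s # w) @ [t])) + 5 *\<^sub>R (of_int c *\<^sub>R z + 5 *\<^sub>R (gen s *v y))"
    by simp
  moreover have "\<not> 5 dvd c * d"
    using c(1) d(1) by (simp add: prime_dvd_mult_iff)
  \<comment> \<open>\<open>gen s *v y\<close> need not be integral, but the factor 5 clears its
    denominators.\<close>
  moreover have "(of_int c *\<^sub>R z + 5 *\<^sub>R (gen s *v y)) $ i \<in> \<int>" for i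
  proof -
    have "5 * (gen s *v y) $ i \<in> \<int>"
      using exhaust_3[of i] c(2) by (auto simp: gen_def algebra_simps)
    then show ?thesis
      using d(2) by simp
  qed
  ultimately show ?case
    by blast
qed

text \<open>For the identity matrix the left side of \<open>word_matrix_dir\<close> would be
  divisible by 5, while the right side is not.\<close>

lemma word_matrix_neq_1:
  assumes "reduced w" "w \<noteq> []"
  shows "word_matrix w \<noteq> mat 1"
proof
  assume eq: "word_matrix w = mat 1"
  \<comment> \<open>Repeating the last letter causes no cancellation, since no letter is its own
    inverse.\<close>
  have "reduced (w @ [last w])"
    using assms by (simp add: successively_append_iff)
  then obtain c :: int and y where c: "\<not> 5 dvd c" "\<forall>i. y $ i \<in> \<int>"
    "5 ^ length w *\<^sub>R dir (last w) = of_int c *\<^sub>R dir (hd (w @ [last w])) + 5 *\<^sub>R y"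
    using word_matrix_dir[of w "last w"] unfolding eq matrix_vector_mul_lid by blast
  have int: "\<exists>k. x = of_int k" if "x \<in> \<int>" for x :: real
    using that by (auto elim: Ints_cases)
  \<comment> \<open>A coordinate in which the direction of the first letter has entry 3, a unit
    modulo 5.\<close>
  define i :: 3 where "i = (if fst (hd (w @ [last w])) then 2 else 1)"
  have di: "dir (hd (w @ [last w])) $ i = 3"
    by (simp add: dir_def i_def Let_def)
  have "dir (last w) $ i \<in> \<int>"
    by (auto simp: dir_def i_def Let_def)
  then obtain a b where a: "dir (last w) $ i = of_int a" and b: "y $ i = of_int b"
    using int c(2) by blast
  have "(5 ^ length w *\<^sub>R dir (last w)) $ i = (of_int c *\<^sub>R dir (hd (w @ [last w])) + 5 *\<^sub>R y) $ i"
    using c(3) by simp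
  then have "5 ^ length w * of_int a = of_int c * 3 + 5 * (of_int b :: real)"
    by (simp add: a b di)
  then have "5 ^ length w * a = c * 3 + 5 * b"
    by (metis (mono_tags) of_int_add of_int_eq_iff of_int_mult of_int_numeral of_int_power)
  moreover have "5 dvd 5 ^ length w * a"
    using assms(2) by (cases w) auto
  ultimately have "5 dvd c * 3 + 5 * b"
    by simp
  with c(1) show False
    by presburger
qed

text \<open>A symmetric rotation is an involution, so this says that the free group is torsion-free
  in degree 2; conjugating away cancelling end letters reduces to \<open>w @ w\<close> being reduced.\<close>

lemma word_matrix_not_symmetric:
  assumes "reduced w" "w \<noteq> []"
  shows "transpose (word_matrix w) \<noteq> word_matrix w"
  using assms
proof (induction w rule: length_induct)
  case (1 w)
  show ?case
  proof
    assume sym: "transpose (word_matrix w) = word_matrix w"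
    \<comment> \<open>A symmetric orthogonal matrix is its own inverse.\<close>
    have "word_matrix (w @ w) = mat 1"
      using orthogonal_word_matrix[of w] sym by (simp add: word_matrix_append orthogonal_matrix_def)
    then have "\<not> reduced (w @ w)"
      using word_matrix_neq_1[of "w @ w"] 1(3) by auto
    then have hd: "hd w = inverse_letter (last w)"
      using 1(2,3) by (simp add: successively_append_iff)
    define s where "s = hd w"
    obtain u where u: "w = s # u"
      using 1(3) by (cases w) (auto simp: s_def)
    have "u \<noteq> []"
      using hd u by auto
    then obtain v where v: "w = s # v @ [inverse_letter s]"
      using hd u by (metis append_butlast_last_id inverse_letter_inverse last_ConsR list.sel(1))
    \<comment> \<open>If \<open>v\<close> were empty, \<open>w\<close> would consist of two
      cancelling letters.\<close>
    have "v \<noteq> []" "reduced v"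
      using 1(2) v by (auto simp: successively_Cons successively_append_iff)
    moreover have "word_matrix v = gen (inverse_letter s) ** word_matrix w ** gen s"
    proof -
      have "gen (inverse_letter s) ** word_matrix w ** gen s =
          (gen (inverse_letter s) ** gen s) ** word_matrix v ** (gen (inverse_letter s) ** gen s)"
        by (simp add: v word_matrix_append matrix_mul_assoc)
      then show ?thesis
        by (simp add: gen_inverse_letter)
    qed
    then have "transpose (word_matrix v) = word_matrix v"
      by (simp add: matrix_transpose_mul sym transpose_gen matrix_mul_assoc)
    moreover have "length v < length w"
      by (simp add: v)
    ultimately show False
      using 1(1) by blast
  qed
qed

section \<open>Rational lines\<close>

text \<open>An explicit set that is preserved by rational matrices and contains the axes of all
  nontrivial words, as well as the origin.\<close>

definition rational_lines :: "(real ^ 3) set"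
  where "rational_lines = {t *\<^sub>R q | t q. \<forall>i. q $ i \<in> \<rat>}"

lemma rational_linesI:
  assumes "\<And>i. q $ i \<in> \<rat>" "x = t *\<^sub>R q"
  shows "x \<in> rational_lines"
  using assms unfolding rational_lines_def by blast

lemma rational_lines_mult:
  assumes "x \<in> rational_lines" "\<And>i j. A $ i $ j \<in> \<rat>"
  shows "A *v x \<in> rational_lines"
proof -
  obtain t q where "x = t *\<^sub>R q" "\<forall>i. q $ i \<in> \<rat>"
    using assms(1) by (auto simp: rational_lines_def)
  then show ?thesis
    using assms(2) by (intro rational_linesI[where q = "A *v q" and t = t])
      (auto simp: matrix_vector_mult_def vec_eq_iff sum_distrib_left ac_simps intro!: Rats_sum)
qed

text \<open>The axis of a rotation is spanned by the axial vector of its antisymmetric part.\<close>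

lemma fixed_point_in_rational_lines:
  assumes rat: "\<And>i j. A $ i $ j \<in> \<rat>" and orth: "orthogonal_matrix A"
    and asym: "transpose A \<noteq> A" and fixed: "A *v x = x"
  shows "x \<in> rational_lines"
proof -
  define v :: "real ^ 3" where
    "v = vector [A $ 3 $ 2 - A $ 2 $ 3, A $ 1 $ 3 - A $ 3 $ 1, A $ 2 $ 1 - A $ 1 $ 2]"
  \<comment> \<open>Since \<open>A\<close> is orthogonal, its transpose fixes \<open>x\<close> too.
    Hence the antisymmetric part of \<open>A\<close> kills \<open>x\<close>, which says that the
    cross product of \<open>v\<close> and \<open>x\<close> vanishes.\<close>
  have "transpose A *v x = transpose A *v (A *v x)"
    by (simp only: fixed)
  also have "\<dots> = x"
    using orth by (simp only: matrix_vector_mul_assoc orthogonal_matrix_def matrix_vector_mul_lid)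
  finally have "(A *v x) $ i = (transpose A *v x) $ i" for i
    by (simp only: fixed)
  from this[of 1] this[of 2] this[of 3]
  have cross: "v $ 2 * x $ 3 = v $ 3 * x $ 2" "v $ 3 * x $ 1 = v $ 1 * x $ 3" "v $ 1 * x $ 2 = v $ 2 * x $ 1"
    by (simp_all add: v_def matrix_vector_mult_def sum_3 transpose_def algebra_simps
        del: transpose_matrix_vector)
  have "v $ i \<in> \<rat>" for i
    using exhaust_3[of i] rat by (auto simp: v_def)
  moreover obtain i where i: "v $ i \<noteq> 0"
  proof (rule ccontr)
    assume "\<not> thesis"
    then have "v $ 1 = 0" "v $ 2 = 0" "v $ 3 = 0"
      using that by blast+
    then have "transpose A = A"
      by (simp add: v_def transpose_def vec_eq_iff forall_3)
    with asym show False ..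
  qed
  have "x = (x $ i / v $ i) *\<^sub>R v"
    using exhaust_3[of i] i cross by (auto simp: vec_eq_iff forall_3 field_simps)
  ultimately show ?thesis
    by (rule rational_linesI)
qed

section \<open>Rotations through 60 degrees and the irrationality of the square root of 3\<close>

lemma rational_eq_sqrt_3_mult:
  assumes "p \<in> \<rat>" "q \<in> \<rat>" "p = sqrt 3 * q"
  shows "p = 0" "q = 0"
proof -
  have "sqrt 3 \<notin> \<rat>"
  proof
    assume "sqrt 3 \<in> \<rat>"
    then obtain m n :: nat where mn: "n \<noteq> 0" "\<bar>sqrt 3\<bar> = m / n" "coprime m n"
      by (rule Rats_abs_nat_div_natE)
    then have "real m = sqrt 3 * n"
      by (simp add: field_simps)
    then have "(real m)\<^sup>2 = 3 * (real n)\<^sup>2"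
      by (simp add: power_mult_distrib)
    then have eq: "m\<^sup>2 = 3 * n\<^sup>2"
      by (metis (mono_tags) of_nat_eq_iff of_nat_mult of_nat_numeral of_nat_power)
    have pr: "prime (3 :: nat)"
      by simp
    have "3 dvd m"
      using eq pr by (metis dvd_triv_left prime_dvd_power)
    then obtain k where "m = 3 * k" ..
    then have "3 * k\<^sup>2 = n\<^sup>2"
      using eq by (simp add: power_mult_distrib)
    then have "3 dvd n"
      using pr by (metis dvd_triv_left prime_dvd_power)
    with \<open>3 dvd m\<close> mn(3) show False
      using coprime_common_divisor_nat[of m n 3] by simp
  qed
  moreover have "sqrt 3 = p / q" if "q \<noteq> 0"
    using that assms(3) by simp
  ultimately show "q = 0"
    using assms(1,2) by (metis Rats_divide)
  then show "p = 0"
    using assms(3) by simp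
qed

text \<open>The left sides are twice the vector \<open>(p, q)\<close> rotated by 60 degrees. If it
  is parallel to \<open>(p', q')\<close>, irrationality makes both the determinant and the inner
  product of the two rational vectors vanish, so one of them is zero.\<close>

lemma rotate_60_irrational:
  assumes "p \<in> \<rat>" "q \<in> \<rat>" "p' \<in> \<rat>" "q' \<in> \<rat>"
    and "p - sqrt 3 * q = r * p'" "sqrt 3 * p + q = r * q'"
  shows "p = 0" "q = 0"
proof -
  have "(p - sqrt 3 * q) * q' = (sqrt 3 * p + q) * p'"
    unfolding assms(5,6) by simp
  then have eq: "p * q' - q * p' = sqrt 3 * (p * p' + q * q')"
    by (simp add: algebra_simps)
  have z: "p * q' - q * p' = 0" "p * p' + q * q' = 0"
    using rational_eq_sqrt_3_mult[OF _ _ eq] assms(1-4) by auto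
  have "(p\<^sup>2 + q\<^sup>2) * (p'\<^sup>2 + q'\<^sup>2) = (p * q' - q * p')\<^sup>2 + (p * p' + q * q')\<^sup>2"
    by (simp add: power2_eq_square algebra_simps)
  then have "p\<^sup>2 + q\<^sup>2 = 0 \<or> p'\<^sup>2 + q'\<^sup>2 = 0"
    by (simp add: z)
  moreover have "p\<^sup>2 + q\<^sup>2 = 0" if "p'\<^sup>2 + q'\<^sup>2 = 0"
  proof -
    have "p - sqrt 3 * q = 0" "sqrt 3 * p + q = 0"
      using that assms(5,6) by (auto simp: sum_power2_eq_zero_iff)
    then show ?thesis
      using rational_eq_sqrt_3_mult[of p q] assms(1,2) by auto
  qed
  ultimately show "p = 0" "q = 0"
    by (auto simp: sum_power2_eq_zero_iff)
qed

text \<open>Only the two coordinates in the plane of rotation matter; keeping them arbitrary covers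
  rotations about the \<open>z\<close>-axis and the \<open>x\<close>-axis alike.\<close>

lemma rotate_60_notin_rational_lines:
  assumes x: "x \<in> rational_lines" and ab: "x $ a \<noteq> 0 \<or> x $ b \<noteq> 0"
    and y: "y $ a = 1/2 * x $ a - sqrt 3 / 2 * x $ b" "y $ b = sqrt 3 / 2 * x $ a + 1/2 * x $ b"
  shows "y \<notin> rational_lines"
proof
  assume "y \<in> rational_lines"
  then obtain t' q' where q': "y = t' *\<^sub>R q'" "\<And>i. q' $ i \<in> \<rat>"
    by (auto simp: rational_lines_def)
  obtain t q where q: "x = t *\<^sub>R q" "\<And>i. q $ i \<in> \<rat>"
    using x by (auto simp: rational_lines_def)
  have "t \<noteq> 0"
    using ab q(1) by auto
  have "q $ a - sqrt 3 * q $ b = 2 * t' / t * q' $ a" "sqrt 3 * q $ a + q $ b = 2 * t' / t * q' $ b"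
    using y \<open>t \<noteq> 0\<close> unfolding q(1) q'(1) by (simp_all add: field_simps)
  then have "q $ a = 0" "q $ b = 0"
    using rotate_60_irrational[OF q(2) q(2) q'(2) q'(2)] by blast+
  then show False
    using ab q(1) by simp
qed

section \<open>The paradoxical decomposition of the ball\<close>

lemma rotation_about_closed:
  "rotation_matrix R \<Longrightarrow> rotation_about c R \<in> carrier rotation_group"
  using rotation_about_Bij unfolding rotation_group_def carrier_subgroup_generated
  by (blast intro: generate.incl)

lemma rotation_about_0: "rotation_about 0 R = (*v) R"
  by (simp add: rotation_about_def fun_eq_iff)

lemma norm_rotation_matrix:
  fixes R :: "real ^ 'n ^ 'n"
  assumes "rotation_matrix R"
  shows "norm (R *v x) = norm x"
  using assms orthogonal_transformation_matrix[of "(*v) R"]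
  by (intro orthogonal_transformation_norm) (simp add: rotation_matrix_def)

theorem theorem5p10:
  shows "\<exists>B1 B2 :: (real ^ 3) set.
           B1 \<subseteq> cball 0 1 \<and> B2 \<subseteq> cball 0 1 \<and>
           B1 \<union> B2 = cball 0 1 \<and> B1 \<inter> B2 = {} \<and>
           equidecomposable rotation_group (\<lambda>f. f) B1 (cball 0 1) \<and>
           equidecomposable rotation_group (\<lambda>f. f) B2 (cball 0 1)"
proof -
  interpret group_action rotation_group UNIV "\<lambda>f. f"
    by (rule rotation_group_action)
  define X :: "(real ^ 3) set" where "X = cball 0 1 - rational_lines"
  have gen_closed: "gen s *v x \<in> X" if "x \<in> X" for s x
    using that rational_lines_mult[of "gen s *v x" "gen (inverse_letter s)"] Rats_gen
    by (auto simp: X_def gen_mult_inverse_letter norm_rotation_matrix rotation_matrix_gen)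
  have free: "foldr (\<lambda>s. (*v) (gen s)) w x \<noteq> x" if "x \<in> X" "reduced w" "w \<noteq> []" for w x
    using that fixed_point_in_rational_lines[OF Rats_word_matrix orthogonal_word_matrix
        word_matrix_not_symmetric]
    unfolding foldr_gen X_def by blast
  obtain P where P: "\<And>s. P s \<subseteq> X" "\<And>s t. s \<noteq> t \<Longrightarrow> P s \<inter> P t = {}"
    "\<And>s x. x \<in> X \<Longrightarrow> x \<notin> P (inverse_letter s) \<Longrightarrow> gen s *v x \<in> P s"
    using free_action_pieces[of "\<lambda>s. (*v) (gen s)" X] gen_mult_inverse_letter gen_closed free
    by metis
  have rot: "(*v) R \<in> carrier rotation_group" if "rotation_matrix R" for R
    using rotation_about_closed[OF that, of 0] by (simp add: rotation_about_0)
  \<comment> \<open>This squeezes all of \<open>X\<close> into the points whose words begin with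
    \<open>s\<close> or its inverse; the two generators thus yield disjoint images.\<close>
  define e where "e s = (\<lambda>x. if x \<in> P (inverse_letter s) then x else gen s *v x)" for s
  have e: "embedding X (P s \<union> P (inverse_letter s)) (e s)" for s
    unfolding e_def
  proof (rule embedding_pieces)
    show "(*v) (gen s) \<in> carrier rotation_group"
      by (rule rot[OF rotation_matrix_gen])
    show "P s \<inter> P (inverse_letter s) = {}"
      by (rule P(2)) simp
  qed (use P in auto)
  define f h where "f = e (False, True)" and "h = e (True, True)"
  have fX: "embedding X X f" and hX: "embedding X X h"
    using e P(1) unfolding f_def h_def embedding_def by (meson Un_least order_trans)+
  have disj: "f ` X \<inter> h ` X = {}"
  proof -
    have "f ` X \<subseteq> P (False, True) \<union> P (False, False)" "h ` X \<subseteq> P (True, True) \<union> P (True, False)"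
      using e[of "(False, True)"] e[of "(True, True)"]
      by (auto simp: f_def h_def embedding_def inverse_letter_def)
    moreover have "(P (False, True) \<union> P (False, False)) \<inter> (P (True, True) \<union> P (True, False)) = {}"
      using P(2) by (simp add: Int_Un_distrib Int_Un_distrib2)
    ultimately show ?thesis
      by blast
  qed
  note union = embedding_Un[OF fX hX disj _ _ subset_UNIV subset_UNIV]
  define Rz Rx where "Rz = rotz (1/2) (sqrt 3 / 2)" and "Rx = rotx (1/2) (sqrt 3 / 2)"
  have R: "rotation_matrix Rz" "rotation_matrix Rx"
    unfolding Rz_def Rx_def by (rule rotation_matrix_rot; simp add: power_divide)+
  \<comment> \<open>A rotation through 60 degrees works on points off its axis: \<open>C\<close>
    lies off the \<open>z\<close>-axis, and \<open>D\<close>, on the \<open>z\<close>-axis without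
    the origin, lies off the \<open>x\<close>-axis.\<close>
  define C where "C = {x \<in> cball 0 1 \<inter> rational_lines. x $ 1 \<noteq> 0 \<or> x $ 2 \<noteq> 0}"
  define D where "D = {x \<in> cball 0 1 \<inter> rational_lines. x $ 1 = 0 \<and> x $ 2 = 0 \<and> x $ 3 \<noteq> 0}"
  have "Rz *v x \<notin> rational_lines" if "x \<in> C" for x
    using that rotate_60_notin_rational_lines[of x 1 2 "Rz *v x"] by (simp add: C_def Rz_def)
  then have "embedding C X ((*v) Rz)"
    by (intro embedding_action[OF rot[OF R(1)]])
      (auto simp: C_def X_def norm_rotation_matrix[OF R(1)])
  moreover have "Rx *v x \<notin> rational_lines" if "x \<in> D" for x
    using that rotate_60_notin_rational_lines[of x 2 3 "Rx *v x"] by (simp add: D_def Rx_def)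
  then have "embedding D X ((*v) Rx)"
    by (intro embedding_action[OF rot[OF R(2)]])
      (auto simp: D_def X_def norm_rotation_matrix[OF R(2)])
  moreover have "\<exists>k. embedding {0} X k"
  proof -
    \<comment> \<open>The origin, \<open>c\<close> and \<open>Rz *v c\<close> form an equilateral
      triangle, so turning by -60 degrees about \<open>c\<close> takes the origin to
      \<open>Rz *v c\<close>, which lies in the ball but on no rational line.\<close>
    define c :: "real ^ 3" where "c = vector [1/2, 0, 0]"
    define g where "g = rotation_about c (rotz (1/2) (- sqrt 3 / 2))"
    have "rotation_matrix (rotz (1/2) (- sqrt 3 / 2))"
      by (rule rotation_matrix_rot) (simp add: power_divide)
    then have "g \<in> carrier rotation_group"
      unfolding g_def by (rule rotation_about_closed)
    moreover have g0: "g 0 = Rz *v c"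
      by (simp add: g_def rotation_about_def Rz_def c_def vec_eq_iff forall_3)
    have "c $ i \<in> \<rat>" for i
      using exhaust_3[of i] by (auto simp: c_def)
    then have "c \<in> rational_lines"
      by (rule rational_linesI[of c _ 1]) simp
    then have "Rz *v c \<notin> rational_lines"
      by (rule rotate_60_notin_rational_lines[of _ 1 2]) (simp_all add: Rz_def c_def)
    moreover have "norm c \<le> 1"
      by (simp add: c_def norm_vec_def L2_set_def sum_3)
    ultimately have "embedding {0} X g"
      using g0 by (intro embedding_action) (auto simp: X_def norm_rotation_matrix[OF R(1)])
    then show ?thesis
      by (rule exI[of _ g])
  qed
  moreover have "embedding X X (\<lambda>x. x)"
    by (rule embedding_id) auto
  ultimately have "\<exists>k. embedding (X \<union> (C \<union> (D \<union> {0}))) X k"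
    using union by metis
  moreover have "X \<union> (C \<union> (D \<union> {0})) = cball 0 1"
    by (auto simp: X_def C_def D_def vec_eq_iff forall_3)
  ultimately obtain k where k: "embedding (cball 0 1) X k"
    by auto
  have fk: "embedding (cball 0 1) X (f \<circ> k)" and hk: "embedding (cball 0 1) X (h \<circ> k)"
    using embedding_comp[OF k fX] embedding_comp[OF k hX] by auto
  \<comment> \<open>\<open>B1\<close> is one copy of the ball. Its complement \<open>B2\<close>
    contains the disjoint copy given by \<open>h \<circ> k\<close> and lies in the ball, so
    Schroeder-Bernstein applies to it.\<close>
  define B1 where "B1 = (f \<circ> k) ` cball 0 1"
  define B2 where "B2 = cball 0 1 - B1"
  have B1: "B1 \<subseteq> cball 0 1"
    using fk by (auto simp: B1_def embedding_def X_def)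
  have "(h \<circ> k) ` cball 0 1 \<inter> B1 = {}"
    using k disj unfolding B1_def embedding_def image_comp[symmetric] by blast
  then have "(h \<circ> k) ` cball 0 1 \<subseteq> B2"
    using hk by (auto simp: B2_def embedding_def X_def)
  then have "embedding (cball 0 1) B2 (h \<circ> k)"
    using hk by (simp add: embedding_def)
  moreover have "embedding B2 (cball 0 1) (\<lambda>x. x)"
    by (rule embedding_id) (auto simp: B2_def)
  ultimately have "equidecomposable rotation_group (\<lambda>f. f) B2 (cball 0 1)"
    by (intro equidecomposable_Schroeder_Bernstein) auto
  moreover have "embedding (cball 0 1) B1 (f \<circ> k)"
    using fk by (simp add: embedding_def B1_def)
  then have "equidecomposable rotation_group (\<lambda>f. f) B1 (cball 0 1)"
    using embedding_id[of B1 "cball 0 1"] B1 by (intro equidecomposable_Schroeder_Bernstein) auto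
  ultimately show ?thesis
    using B1 by (intro exI[of _ B1] exI[of _ B2]) (auto simp: B2_def)
qed

end
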